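(* For $i,j\in I_N$, $i\neq j$, let $$\psi_{ij}(\cdot)=\frac{f_i(\cdot)-f_j(\cdot)}{\|f_i-f_j\|_2},\qquad u_{ij}=\tfrac12(f_i+f_j),$$ and for $i\in I_N$ let $$\bar M_i:=\max_{j\in I_N,\ j\neq i}\Big\{\int\psi_{ij}(t)u_{ij}(t)\,dt-\int\psi_{ij}(t)Y_\varepsilon(dt)\Big\}.$$ Let $\bar i=\arg\min_{i\in I_N}\bar M_i$ and $\bar f=f_{\bar i}$. Then $$\mathcal{R}_2[\bar f;f]\le\min_{i\in I_N}\|f_i-f\|_2+8\varepsilon\sqrt{2\ln N}.$$
   Context: Model: $\mathcal{D}_0=[0,1]^d$, $\varepsilon\in(0,1)$, and one observes $\mathcal{Y}_\varepsilon$ in the Gaussian white noise model $Y_\varepsilon(dt)=f(t)\,dt+\varepsilon W(dt)$, $t\in\mathcal{D}_0$, with $f\in\mathbb{L}_2(\mathcal{D}_0)$ unknown and $W$ the standard Wiener process in $\mathbb{R}^d$. Thus for $\psi\in\mathbb{L}_2(\mathcal{D}_0)$ one observes $\int\psi(t)Y_\varepsilon(dt)=\int\psi f\,dt+\varepsilon Z(\psi)$, where $Z(\psi)=\int\psi(t)W(dt)$ is the zero-mean Gaussian process, linear in $\psi$, with $\mathbb{E}[Z(\psi)Z(\phi)]=\int\psi\phi\,dt$. $\|\cdot\|_2$ is the $\mathbb{L}_2$-norm on $\mathcal{D}_0$; $\mathcal{R}_2[\tilde f;f]:=\mathbb{E}_f\|\tilde f-f\|_2$ (not squared), with $\mathbb{E}_f$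 the expectation under the model with signal $f$. Family: $I_N=\{1,\dots,N\}$, $N\ge2$, and $f_1,\dots,f_N\in\mathbb{L}_2(\mathcal{D}_0)$ are distinct fixed (nonrandom) functions. Ties in $\arg\min$ are broken arbitrarily (measurably). *)

theory Defs
  imports "HOL-Probability.Probability"
begin

definition cube_measure :: "(real ^ 'd) measure" where
  "cube_measure = lebesgue_on (cbox 0 1)"

text \<open>Square-integrable functions are honest functions here, not equivalence classes; only their
  restriction to the cube, up to null sets, matters. Equality in $L_2$ is therefore rendered as
  equality almost everywhere.\<close>

definition L2_cube :: "(real ^ 'd \<Rightarrow> real) set" where
  "L2_cube = {g \<in> borel_measurable cube_measure. integrable cube_measure (\<lambda>t. (g t)\<^sup>2)}"

definition L2_inner :: "(real ^ 'd \<Rightarrow> real) \<Rightarrow> (real ^ 'd \<Rightarrow> real) \<Rightarrow> real" where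
  "L2_inner g h = (\<integral>t. g t * h t \<partial>cube_measure)"

definition L2_norm :: "(real ^ 'd \<Rightarrow> real) \<Rightarrow> real" where
  "L2_norm g = sqrt (\<integral>t. (g t)\<^sup>2 \<partial>cube_measure)"

text \<open>The normal law with mean \<open>m\<close> and standard deviation \<open>s\<close>, a point mass when \<open>s = 0\<close>
  (\<^term>\<open>normal_density m 0\<close> is not a probability density).\<close>

definition normal_law :: "real \<Rightarrow> real \<Rightarrow> real measure" where
  "normal_law m s =
    (if s = 0 then return borel m else density lborel (\<lambda>x. ennreal (normal_density m s x)))"

definition gaussian_rv :: "'w measure \<Rightarrow> ('w \<Rightarrow> real) \<Rightarrow> bool" where
  "gaussian_rv M X \<longleftrightarrow>
    X \<in> borel_measurable M \<and> (\<exists>m s. s \<ge> 0 \<and> distr M borel X = normal_law m s)"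

text \<open>\<open>Z \<psi>\<close> is the Wiener integral of \<open>\<psi>\<close>. As Wiener integrals are only determined almost surely,
  linearity is required almost surely, with an exceptional set that may depend on the arguments.\<close>

locale white_noise = prob_space M
  for M :: "'w measure" and Z :: "(real ^ 'd \<Rightarrow> real) \<Rightarrow> 'w \<Rightarrow> real" +
  assumes gaussian_process:
      "\<And>S c. finite S \<Longrightarrow> S \<subseteq> L2_cube \<Longrightarrow> gaussian_rv M (\<lambda>\<omega>. \<Sum>\<psi>\<in>S. c \<psi> * Z \<psi> \<omega>)"
    and zero_mean: "\<And>\<psi>. \<psi> \<in> L2_cube \<Longrightarrow> expectation (Z \<psi>) = 0"
    and covariance: "\<And>\<psi> \<phi>. \<psi> \<in> L2_cube \<Longrightarrow> \<phi> \<in> L2_cube \<Longrightarrow>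
      expectation (\<lambda>\<omega>. Z \<psi> \<omega> * Z \<phi> \<omega>) = L2_inner \<psi> \<phi>"
    and linear: "\<And>\<psi> \<phi> a b. \<psi> \<in> L2_cube \<Longrightarrow> \<phi> \<in> L2_cube \<Longrightarrow>
      AE \<omega> in M. Z (\<lambda>t. a * \<psi> t + b * \<phi> t) \<omega> = a * Z \<psi> \<omega> + b * Z \<phi> \<omega>"

text \<open>The observed integral of \<open>\<psi>\<close> against \<open>Y(dt) = f(t) dt + \<epsilon> W(dt)\<close>.\<close>

definition observation ::
  "real \<Rightarrow> (real ^ 'd \<Rightarrow> real) \<Rightarrow> ((real ^ 'd \<Rightarrow> real) \<Rightarrow> 'w \<Rightarrow> real)
    \<Rightarrow> (real ^ 'd \<Rightarrow> real) \<Rightarrow> 'w \<Rightarrow> real" where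
  "observation \<epsilon> f Z \<psi> \<omega> = L2_inner \<psi> f + \<epsilon> * Z \<psi> \<omega>"

definition risk ::
  "'w measure \<Rightarrow> ('w \<Rightarrow> real ^ 'd \<Rightarrow> real) \<Rightarrow> (real ^ 'd \<Rightarrow> real) \<Rightarrow> real" where
  "risk M fh f = (\<integral>\<omega>. L2_norm (\<lambda>t. fh \<omega> t - f t) \<partial>M)"

definition psi :: "(nat \<Rightarrow> real ^ 'd \<Rightarrow> real) \<Rightarrow> nat \<Rightarrow> nat \<Rightarrow> real ^ 'd \<Rightarrow> real" where
  "psi F i j t = (F i t - F j t) / L2_norm (\<lambda>s. F i s - F j s)"

definition mid :: "(nat \<Rightarrow> real ^ 'd \<Rightarrow> real) \<Rightarrow> nat \<Rightarrow> nat \<Rightarrow> real ^ 'd \<Rightarrow> real" where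
  "mid F i j t = (F i t + F j t) / 2"

definition selection_stat ::
  "nat \<Rightarrow> (nat \<Rightarrow> real ^ 'd \<Rightarrow> real) \<Rightarrow> ((real ^ 'd \<Rightarrow> real) \<Rightarrow> 'w \<Rightarrow> real)
    \<Rightarrow> nat \<Rightarrow> 'w \<Rightarrow> real" where
  "selection_stat N F Y i \<omega> =
    (MAX j\<in>{1..N} - {i}. L2_inner (psi F i j) (mid F i j) - Y (psi F i j) \<omega>)"

end

theory Submission
  imports Defs
begin

text \<open>
  Write \<open>a i\<close> for the distance of \<open>F i\<close> to the signal and \<open>d i j\<close> for the distance of \<open>F i\<close> to \<open>F j\<close>.
  Expanding squares, the entry of the maximum defining the statistic of \<open>i\<close> that belongs to \<open>j\<close> is
  \<open>((a i)\<^sup>2 - (a j)\<^sup>2) / (2 * d i j)\<close> minus the noise \<open>\<epsilon> * Z (psi F i j)\<close>: up to noise, it compares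
  the two candidates. Let \<open>i0\<close> be the best candidate and \<open>k\<close> the selected one.

  For \<open>i0\<close> all comparison terms are nonpositive, so its statistic is at most the largest of the noises
  \<open>- \<epsilon> * Z (psi F i0 j)\<close>. For \<open>k \<noteq> i0\<close> the entry at \<open>j = i0\<close> is at least \<open>(a k - a i0) / 2\<close> minus a
  noise, because \<open>d k i0 \<le> a k + a i0\<close>; and as \<open>psi\<close> is antisymmetric in its indices, this noise
  is again, almost surely, one of those attached to \<open>i0\<close>. Since \<open>k\<close> minimises the statistic, the
  excess \<open>a k - a i0\<close> is at most four times the largest of zero and the noises attached to \<open>i0\<close>
  (lemma \<open>argmin_excess_le\<close>).

  The direction \<open>psi F i0 j\<close> has unit norm, so these noises are \<open>\<epsilon>\<close> times \<open>N - 1\<close> standard normal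
  variables. Together with zero they are \<open>N\<close> variables whose exponential moments do not exceed
  \<open>exp (t\<^sup>2 / 2)\<close>, and the expectation of their maximum is at most \<open>sqrt (2 * ln N)\<close>
  (lemma \<open>standard_normal_majorant\<close>). The excess risk is thus even at most
  \<open>4 * \<epsilon> * sqrt (2 * ln N)\<close>.
\<close>

section \<open>Square-integrable functions on the cube\<close>

lemma L2_cube_integrable_mult:
  assumes "g \<in> L2_cube" "h \<in> L2_cube"
  shows "integrable cube_measure (\<lambda>t. g t * h t)"
proof (rule Bochner_Integration.integrable_bound)
  show "integrable cube_measure (\<lambda>t. (g t)\<^sup>2 + (h t)\<^sup>2)"
    using assms by (auto simp: L2_cube_def)
  show "(\<lambda>t. g t * h t) \<in> borel_measurable cube_measure"
    using assms by (auto simp: L2_cube_def)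
  have "\<bar>x * y\<bar> \<le> x\<^sup>2 + y\<^sup>2" for x y :: real
  proof -
    have "0 \<le> (x + y)\<^sup>2" "0 \<le> (x - y)\<^sup>2" "0 \<le> x\<^sup>2" "0 \<le> y\<^sup>2" by auto
    then show ?thesis by (auto simp: power2_sum power2_diff abs_if)
  qed
  then show "AE t in cube_measure. norm (g t * h t) \<le> norm ((g t)\<^sup>2 + (h t)\<^sup>2)"
    by simp
qed

lemma L2_cube_linear:
  assumes "g \<in> L2_cube" "h \<in> L2_cube"
  shows "(\<lambda>t. a * g t + b * h t) \<in> L2_cube"
proof -
  have "(\<lambda>t. (a * g t + b * h t)\<^sup>2)
      = (\<lambda>t. a\<^sup>2 * (g t)\<^sup>2 + b\<^sup>2 * (h t)\<^sup>2 + (2 * a * b) * (g t * h t))"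
    by (auto simp: power2_eq_square algebra_simps)
  then have "integrable cube_measure (\<lambda>t. (a * g t + b * h t)\<^sup>2)"
    using assms L2_cube_integrable_mult[OF assms] by (simp add: L2_cube_def)
  then show ?thesis
    using assms by (auto simp: L2_cube_def)
qed

lemma L2_cube_diff: "g \<in> L2_cube \<Longrightarrow> h \<in> L2_cube \<Longrightarrow> (\<lambda>t. g t - h t) \<in> L2_cube"
  using L2_cube_linear[of g h 1 "-1"] by simp

lemma L2_norm_nonneg: "0 \<le> L2_norm g"
  by (simp add: L2_norm_def)

lemma L2_norm_power2: "(L2_norm g)\<^sup>2 = (\<integral>t. (g t)\<^sup>2 \<partial>cube_measure)"
  by (simp add: L2_norm_def)

lemma L2_norm_minus_commute: "L2_norm (\<lambda>t. g t - h t) = L2_norm (\<lambda>t. h t - g t)"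
  by (simp add: L2_norm_def power2_commute)

lemma L2_norm_power2_linear:
  assumes "g \<in> L2_cube" "h \<in> L2_cube"
  shows "(L2_norm (\<lambda>t. a * g t + b * h t))\<^sup>2
    = a\<^sup>2 * (L2_norm g)\<^sup>2 + b\<^sup>2 * (L2_norm h)\<^sup>2 + 2 * a * b * L2_inner g h"
proof -
  have "(\<lambda>t. (a * g t + b * h t)\<^sup>2)
      = (\<lambda>t. a\<^sup>2 * (g t)\<^sup>2 + b\<^sup>2 * (h t)\<^sup>2 + (2 * a * b) * (g t * h t))"
    by (auto simp: power2_eq_square algebra_simps)
  then show ?thesis
    using assms L2_cube_integrable_mult[OF assms]
    by (simp add: L2_norm_power2 L2_inner_def L2_cube_def)
qed

lemma L2_Cauchy_Schwarz:
  assumes "g \<in> L2_cube" "h \<in> L2_cube"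
  shows "\<bar>L2_inner g h\<bar> \<le> L2_norm g * L2_norm h"
proof -
  define A B C where "A = (L2_norm g)\<^sup>2" and "B = (L2_norm h)\<^sup>2" and "C = L2_inner g h"
  have form: "0 \<le> a\<^sup>2 * A + b\<^sup>2 * B + 2 * a * b * C" for a b
    using L2_norm_power2_linear[OF assms, of a b]
    by (metis A_def B_def C_def zero_le_power2)
  have "C\<^sup>2 \<le> A * B"
  proof (cases "B = 0")
    case True
    have "C = 0"
    proof (rule ccontr)
      assume "C \<noteq> 0"
      \<comment> \<open>With \<open>B = 0\<close> the form is affine in \<open>b\<close>; at this \<open>b\<close> it takes the value \<open>-1\<close>.\<close>
      then show False
        using form[of 1 "- (A + 1) / (2 * C)"] True A_def by (simp add: field_simps)
    qed
    with True show ?thesis by simp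
  next
    case False
    then have "0 < B" by (simp add: B_def)
    \<comment> \<open>Up to scaling, \<open>(B, - C)\<close> is the point where the form is smallest.\<close>
    have "0 \<le> B * (A * B - C\<^sup>2)"
      using form[of B "- C"] by (simp add: power2_eq_square algebra_simps)
    with \<open>0 < B\<close> show ?thesis by (simp add: zero_le_mult_iff)
  qed
  then have "C\<^sup>2 \<le> (L2_norm g * L2_norm h)\<^sup>2"
    by (simp add: A_def B_def power_mult_distrib)
  then show ?thesis
    unfolding C_def by (simp add: abs_le_square_iff[symmetric] L2_norm_nonneg)
qed

lemma L2_norm_triangle_diff:
  assumes "g \<in> L2_cube" "h \<in> L2_cube" "f \<in> L2_cube"
  shows "L2_norm (\<lambda>t. g t - h t) \<le> L2_norm (\<lambda>t. g t - f t) + L2_norm (\<lambda>t. h t - f t)"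
proof -
  define u v where "u = (\<lambda>t. g t - f t)" and "v = (\<lambda>t. h t - f t)"
  have uv: "u \<in> L2_cube" "v \<in> L2_cube"
    using assms by (auto simp: u_def v_def intro: L2_cube_diff)
  have "(L2_norm (\<lambda>t. 1 * u t + (-1) * v t))\<^sup>2
      = (L2_norm u)\<^sup>2 + (L2_norm v)\<^sup>2 - 2 * L2_inner u v"
    using L2_norm_power2_linear[OF uv, of 1 "-1"] by simp
  also have "\<dots> \<le> (L2_norm u + L2_norm v)\<^sup>2"
    using L2_Cauchy_Schwarz[OF uv] by (simp add: power2_sum abs_le_iff)
  finally have "L2_norm (\<lambda>t. 1 * u t + (-1) * v t) \<le> L2_norm u + L2_norm v"
    by (rule power2_le_imp_le) (simp add: L2_norm_nonneg)
  then show ?thesis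
    by (simp add: u_def v_def)
qed

lemma L2_norm_diff_pos:
  assumes "g \<in> L2_cube" "h \<in> L2_cube" "\<not> (AE t in cube_measure. g t = h t)"
  shows "0 < L2_norm (\<lambda>t. g t - h t)"
proof -
  have "integrable cube_measure (\<lambda>t. (g t - h t)\<^sup>2)"
    using L2_cube_diff[OF assms(1,2)] by (simp add: L2_cube_def)
  then have "(\<integral>t. (g t - h t)\<^sup>2 \<partial>cube_measure) \<noteq> 0"
    using assms(3) by (subst integral_nonneg_eq_0_iff_AE) auto
  then have "0 < (\<integral>t. (g t - h t)\<^sup>2 \<partial>cube_measure)"
    by (simp add: less_le)
  then show ?thesis
    by (simp add: L2_norm_def)
qed

section \<open>The test directions\<close>

lemma psi_in_L2_cube:
  assumes "F i \<in> L2_cube" "F j \<in> L2_cube"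
  shows "psi F i j \<in> L2_cube"
proof -
  define d where "d = L2_norm (\<lambda>s. F i s - F j s)"
  have "psi F i j = (\<lambda>t. (1 / d) * F i t + (- 1 / d) * F j t)"
    by (auto simp: psi_def d_def diff_divide_distrib)
  then show ?thesis
    using L2_cube_linear[OF assms, of "1 / d" "- 1 / d"] by simp
qed

lemma psi_antisym: "psi F j i t = - psi F i j t"
  unfolding psi_def L2_norm_minus_commute[of "F j"] by (simp add: divide_simps)

lemma L2_inner_psi_self:
  assumes "0 < L2_norm (\<lambda>t. F i t - F j t)"
  shows "L2_inner (psi F i j) (psi F i j) = 1"
proof -
  define d where "d = L2_norm (\<lambda>t. F i t - F j t)"
  have "L2_inner (psi F i j) (psi F i j) = (\<integral>t. (F i t - F j t)\<^sup>2 / d\<^sup>2 \<partial>cube_measure)"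
    by (simp add: L2_inner_def psi_def d_def power2_eq_square)
  also have "\<dots> = d\<^sup>2 / d\<^sup>2"
    by (simp add: d_def L2_norm_power2)
  finally show ?thesis
    using assms by (simp add: d_def)
qed

text \<open>Half the sum of two functions is the point of the line through them at which the two distances
  agree; measuring the signal against this midpoint therefore compares its distances to both.\<close>

lemma L2_inner_psi_mid:
  assumes "F i \<in> L2_cube" "F j \<in> L2_cube" "f \<in> L2_cube"
  shows "L2_inner (psi F i j) (mid F i j) - L2_inner (psi F i j) f
    = ((L2_norm (\<lambda>t. F i t - f t))\<^sup>2 - (L2_norm (\<lambda>t. F j t - f t))\<^sup>2)
      / (2 * L2_norm (\<lambda>t. F i t - F j t))"
proof -
  define d where "d = L2_norm (\<lambda>t. F i t - F j t)"
  note psi = psi_in_L2_cube[where F = F, OF assms(1,2)]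
  have mid: "mid F i j \<in> L2_cube"
    using L2_cube_linear[OF assms(1,2), of "1 / 2" "1 / 2"]
    by (simp add: mid_def[abs_def] add_divide_distrib)
  have sq: "integrable cube_measure (\<lambda>t. (F i t - f t)\<^sup>2)"
    "integrable cube_measure (\<lambda>t. (F j t - f t)\<^sup>2)"
    using L2_cube_diff assms by (auto simp: L2_cube_def)
  have "L2_inner (psi F i j) (mid F i j) - L2_inner (psi F i j) f
      = (\<integral>t. psi F i j t * mid F i j t - psi F i j t * f t \<partial>cube_measure)"
    unfolding L2_inner_def
    using L2_cube_integrable_mult[OF psi mid] L2_cube_integrable_mult[OF psi assms(3)] by simp
  also have "\<dots> = (\<integral>t. ((F i t - f t)\<^sup>2 - (F j t - f t)\<^sup>2) / (2 * d) \<partial>cube_measure)"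
    by (rule Bochner_Integration.integral_cong)
      (auto simp: psi_def mid_def d_def[symmetric] divide_simps power2_eq_square algebra_simps)
  also have "\<dots> = ((L2_norm (\<lambda>t. F i t - f t))\<^sup>2 - (L2_norm (\<lambda>t. F j t - f t))\<^sup>2) / (2 * d)"
    using sq by (simp add: L2_norm_power2)
  finally show ?thesis
    by (simp add: d_def)
qed

lemma selection_stat_observation:
  assumes "f \<in> L2_cube" "\<And>j. j \<in> {1..N} \<Longrightarrow> F j \<in> L2_cube" "i \<in> {1..N}"
  shows "selection_stat N F (observation \<epsilon> f Z) i \<omega>
    = (MAX j\<in>{1..N} - {i}.
        ((L2_norm (\<lambda>t. F i t - f t))\<^sup>2 - (L2_norm (\<lambda>t. F j t - f t))\<^sup>2)
          / (2 * L2_norm (\<lambda>t. F i t - F j t)) - \<epsilon> * Z (psi F i j) \<omega>)"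
proof -
  have "L2_inner (psi F i j) (mid F i j) - observation \<epsilon> f Z (psi F i j) \<omega>
      = ((L2_norm (\<lambda>t. F i t - f t))\<^sup>2 - (L2_norm (\<lambda>t. F j t - f t))\<^sup>2)
          / (2 * L2_norm (\<lambda>t. F i t - F j t)) - \<epsilon> * Z (psi F i j) \<omega>" if "j \<in> {1..N} - {i}" for j
    using L2_inner_psi_mid[of F i j f] assms that by (simp add: observation_def)
  then show ?thesis
    unfolding selection_stat_def by (intro arg_cong[where f = Max] image_cong refl)
qed

section \<open>The excess of the selected index\<close>

text \<open>The statement is deterministic: \<open>a i\<close> is the loss of the index \<open>i\<close>, \<open>d i j\<close> a separation dominated
  by the sum of the two losses, \<open>z i j\<close> a perturbation of the comparison. Comparing the statistics of
  the minimiser \<open>k\<close> and of the best index \<open>i0\<close> costs one bound \<open>B\<close> for each of them, and the comparison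
  term of \<open>k\<close> against \<open>i0\<close> is worth at least half the excess.\<close>

lemma argmin_excess_le:
  fixes a :: "'i \<Rightarrow> real" and d z :: "'i \<Rightarrow> 'i \<Rightarrow> real" and B :: real
  defines "stat \<equiv> (\<lambda>i I. MAX j\<in>I - {i}. ((a i)\<^sup>2 - (a j)\<^sup>2) / (2 * d i j) - z i j)"
  assumes "finite I" "i0 \<in> I" "k \<in> I" "0 \<le> B"
    and a_nonneg: "\<And>i. i \<in> I \<Longrightarrow> 0 \<le> a i"
    and best: "\<And>i. i \<in> I \<Longrightarrow> a i0 \<le> a i"
    and d_pos: "\<And>i j. i \<in> I \<Longrightarrow> j \<in> I \<Longrightarrow> i \<noteq> j \<Longrightarrow> 0 < d i j"
    and d_le: "\<And>i j. i \<in> I \<Longrightarrow> j \<in> I \<Longrightarrow> d i j \<le> a i + a j"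
    and stat_le: "stat k I \<le> stat i0 I"
    and antisym: "z k i0 = - z i0 k"
    and noise_le: "\<And>j. j \<in> I \<Longrightarrow> j \<noteq> i0 \<Longrightarrow> - z i0 j \<le> B"
  shows "a k - a i0 \<le> 4 * B"
proof (cases "k = i0")
  case True
  with \<open>0 \<le> B\<close> show ?thesis by simp
next
  case False
  define e where "e = (\<lambda>i j. ((a i)\<^sup>2 - (a j)\<^sup>2) / (2 * d i j) - z i j)"
  have e_i0: "e i0 j \<le> B" if "j \<in> I - {i0}" for j
  proof -
    have "(a i0)\<^sup>2 \<le> (a j)\<^sup>2"
      using that best a_nonneg \<open>i0 \<in> I\<close> by (auto intro: power_mono)
    moreover have "0 < d i0 j"
      using that d_pos \<open>i0 \<in> I\<close> by auto
    ultimately have "((a i0)\<^sup>2 - (a j)\<^sup>2) / (2 * d i0 j) \<le> 0"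
      by (simp add: divide_le_0_iff)
    then show ?thesis
      using noise_le[of j] that by (simp add: e_def)
  qed
  have "(a k - a i0) / 2 \<le> ((a k)\<^sup>2 - (a i0)\<^sup>2) / (2 * d k i0)"
  proof -
    have pos: "0 < d k i0" using d_pos False \<open>k \<in> I\<close> \<open>i0 \<in> I\<close> by auto
    have "(a k - a i0) * d k i0 \<le> (a k - a i0) * (a k + a i0)"
      using d_le best \<open>k \<in> I\<close> \<open>i0 \<in> I\<close> by (intro mult_left_mono) auto
    also have "\<dots> = (a k)\<^sup>2 - (a i0)\<^sup>2"
      by (simp add: power2_eq_square algebra_simps)
    finally show ?thesis
      using pos by (simp add: field_simps)
  qed
  then have "(a k - a i0) / 2 - B \<le> e k i0"
    using antisym noise_le[OF \<open>k \<in> I\<close> False] unfolding e_def by linarith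
  also have "\<dots> \<le> stat k I"
    unfolding stat_def e_def using False \<open>finite I\<close> \<open>i0 \<in> I\<close> by (intro Max_ge) auto
  also have "\<dots> \<le> stat i0 I"
    by (rule stat_le)
  also have "\<dots> \<le> B"
    using e_i0 False \<open>finite I\<close> \<open>k \<in> I\<close> unfolding stat_def e_def
    by (subst Max_le_iff) auto
  finally show ?thesis
    by simp
qed

section \<open>Maxima of standard normal variables\<close>

text \<open>Completing the square turns the exponentially tilted standard normal density into the density of
  the normal law with mean \<open>t\<close>, up to the factor \<open>exp (t\<^sup>2 / 2)\<close>.\<close>

lemma has_bochner_integral_exp_std_normal_density:
  "has_bochner_integral lborel (\<lambda>x. std_normal_density x * exp (t * x)) (exp (t\<^sup>2 / 2))"
proof -
  have "std_normal_density x * exp (t * x) = exp (t\<^sup>2 / 2) * normal_density t 1 x" for x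
  proof -
    have "- x\<^sup>2 / 2 + t * x = t\<^sup>2 / 2 + - (x - t)\<^sup>2 / 2"
      by (simp add: power2_eq_square field_simps)
    then have "exp (- x\<^sup>2 / 2) * exp (t * x) = exp (t\<^sup>2 / 2) * exp (- (x - t)\<^sup>2 / 2)"
      by (simp only: exp_add[symmetric])
    then show ?thesis
      by (simp add: normal_density_def)
  qed
  then show ?thesis
    by (simp add: has_bochner_integral_iff)
qed

lemma (in prob_space) standard_normal_exp_moment:
  assumes "distributed M lborel X std_normal_density"
  shows "integrable M (\<lambda>\<omega>. exp (t * X \<omega>))"
    and "expectation (\<lambda>\<omega>. exp (t * X \<omega>)) = exp (t\<^sup>2 / 2)"
proof -
  note mgf = has_bochner_integral_exp_std_normal_density[of t, unfolded has_bochner_integral_iff]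
  show "integrable M (\<lambda>\<omega>. exp (t * X \<omega>))"
    using mgf distributed_integrable[OF assms, of "\<lambda>x. exp (t * x)"] by simp
  show "expectation (\<lambda>\<omega>. exp (t * X \<omega>)) = exp (t\<^sup>2 / 2)"
    using mgf distributed_integral[OF assms, of "\<lambda>x. exp (t * x)"] by simp
qed

text \<open>The moments exclude the degenerate case of \<^const>\<open>normal_law\<close>: a point mass with mean zero has
  second moment zero.\<close>

lemma (in prob_space) gaussian_rv_standardised:
  assumes "gaussian_rv M X" "expectation X = 0" "expectation (\<lambda>\<omega>. X \<omega> * X \<omega>) = 1"
  shows "distributed M lborel X std_normal_density"
proof -
  obtain m s where s: "0 \<le> s" and law: "distr M borel X = normal_law m s"
    and X [measurable]: "X \<in> borel_measurable M"
    using assms(1) by (auto simp: gaussian_rv_def)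
  have "s \<noteq> 0"
  proof
    assume "s = 0"
    have law_int: "expectation (\<lambda>\<omega>. g (X \<omega>)) = g m"
      if [measurable]: "g \<in> borel_measurable borel" for g :: "real \<Rightarrow> real"
    proof -
      have "expectation (\<lambda>\<omega>. g (X \<omega>)) = (\<integral>x. g x \<partial>distr M borel X)"
        by (simp add: integral_distr)
      then show ?thesis
        using \<open>s = 0\<close> by (simp add: law normal_law_def integral_return)
    qed
    show False
      using law_int[of "\<lambda>x. x"] law_int[of "\<lambda>x. x * x"] assms(2,3) by simp
  qed
  with s have "0 < s" by simp
  have D: "distributed M lborel X (normal_density m s)"
    unfolding distributed_def
    using law \<open>s \<noteq> 0\<close> by (simp add: normal_law_def cong: distr_cong)
  have "m = 0"
    using normal_distributed_expectation[OF \<open>0 < s\<close> D] assms(2) by simp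
  have "s\<^sup>2 = 1"
    using normal_distributed_variance[OF \<open>0 < s\<close> D] assms(2,3) by (simp add: power2_eq_square)
  with \<open>0 < s\<close> have "s = 1"
    by (simp add: power2_eq_1_iff)
  with D \<open>m = 0\<close> show ?thesis by simp
qed

text \<open>By \<open>ln y \<le> y - 1\<close>, every real \<open>x\<close> satisfies \<open>t * x \<le> ln A + exp (t * x) / A - 1\<close>. Adding up the
  exponentials gives one random variable above zero and above all \<open>X j\<close>, and its expectation is
  explicit. With \<open>A = n * exp (t\<^sup>2 / 2)\<close>, a bound for the total exponential moment, what remains is
  \<open>ln A / t\<close>, which is smallest at \<open>t = sqrt (2 * ln n)\<close>. A majorant, unlike the maximum itself,
  can be integrated termwise.\<close>

lemma (in prob_space) standard_normal_majorant:
  fixes X :: "'i \<Rightarrow> 'a \<Rightarrow> real"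
  assumes "finite J" "J \<noteq> {}"
    and X: "\<And>j. j \<in> J \<Longrightarrow> distributed M lborel (X j) std_normal_density"
  obtains B where "integrable M B" "expectation B \<le> sqrt (2 * ln (card J + 1))"
    "\<And>\<omega>. 0 \<le> B \<omega>" "\<And>j \<omega>. j \<in> J \<Longrightarrow> X j \<omega> \<le> B \<omega>"
proof -
  define n :: real where "n = card J + 1"
  define t where "t = sqrt (2 * ln n)"
  define A where "A = n * exp (t\<^sup>2 / 2)"
  define S where "S = (\<lambda>\<omega>. 1 + (\<Sum>j\<in>J. exp (t * X j \<omega>)))"
  define B where "B = (\<lambda>\<omega>. (ln A + S \<omega> / A - 1) / t)"
  have "1 < n"
    using assms(1,2) by (simp add: n_def card_gt_0_iff)
  then have "0 < t" "0 < A" and t2: "t\<^sup>2 = 2 * ln n"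
    by (simp_all add: t_def A_def)
  have lnA: "ln A = t\<^sup>2"
    using \<open>1 < n\<close> by (simp add: A_def ln_mult t2)
  have below: "x \<le> B \<omega>" if "exp (t * x) \<le> S \<omega>" for x \<omega>
  proof -
    have "t * x - ln A = ln (exp (t * x) / A)"
      using \<open>0 < A\<close> by (simp add: ln_div)
    also have "\<dots> \<le> exp (t * x) / A - 1"
      using \<open>0 < A\<close> by (intro ln_le_minus_one) simp
    also have "\<dots> \<le> S \<omega> / A - 1"
      using that \<open>0 < A\<close> by (simp add: divide_right_mono)
    finally show ?thesis
      using \<open>0 < t\<close> by (simp add: B_def field_simps)
  qed
  have S_int: "integrable M S"
    unfolding S_def using X standard_normal_exp_moment(1) by auto
  have "expectation S = 1 + card J * exp (t\<^sup>2 / 2)"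
    unfolding S_def using X standard_normal_exp_moment by (simp add: prob_space)
  also have "\<dots> \<le> A"
    by (simp add: A_def n_def algebra_simps)
  finally have S_le: "expectation S \<le> A" .
  show thesis
  proof (rule that[of B])
    show "integrable M B"
      unfolding B_def using S_int by simp
    have "expectation B = (ln A + expectation S / A - 1) / t"
      unfolding B_def using S_int by (simp add: prob_space)
    also have "\<dots> \<le> (ln A + 1 - 1) / t"
      using S_le \<open>0 < A\<close> \<open>0 < t\<close> by (intro divide_right_mono) auto
    also have "\<dots> = t"
      using \<open>0 < t\<close> by (simp add: lnA power2_eq_square)
    finally show "expectation B \<le> sqrt (2 * ln (card J + 1))"
      by (simp add: t_def n_def)
    show "0 \<le> B \<omega>" for \<omega>
      by (rule below) (simp add: S_def sum_nonneg)
    show "X j \<omega> \<le> B \<omega>" if "j \<in> J" for j \<omega>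
    proof (rule below)
      have "exp (t * X j \<omega>) \<le> (\<Sum>j\<in>J. exp (t * X j \<omega>))"
        using that assms(1) by (intro member_le_sum) auto
      then show "exp (t * X j \<omega>) \<le> S \<omega>"
        by (simp add: S_def)
    qed
  qed
qed

section \<open>The noise in the test directions\<close>

context white_noise
begin

lemma distributed_neg_noise:
  assumes "\<psi> \<in> L2_cube" "L2_inner \<psi> \<psi> = 1"
  shows "distributed M lborel (\<lambda>\<omega>. - Z \<psi> \<omega>) std_normal_density"
proof (rule gaussian_rv_standardised)
  show "gaussian_rv M (\<lambda>\<omega>. - Z \<psi> \<omega>)"
    using gaussian_process[of "{\<psi>}" "\<lambda>_. -1"] assms(1) by simp
  show "expectation (\<lambda>\<omega>. - Z \<psi> \<omega>) = 0"
    using zero_mean[OF assms(1)] by simp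
  show "expectation (\<lambda>\<omega>. - Z \<psi> \<omega> * - Z \<psi> \<omega>) = 1"
    using covariance[OF assms(1,1)] assms(2) by simp
qed

lemma AE_noise_psi_antisym:
  assumes "F i \<in> L2_cube" "F j \<in> L2_cube"
  shows "AE \<omega> in M. Z (psi F j i) \<omega> = - Z (psi F i j) \<omega>"
proof -
  have "psi F j i = (\<lambda>t. (-1) * psi F i j t + 0 * psi F i j t)"
    by (simp add: fun_eq_iff psi_antisym[of F j i])
  then show ?thesis
    using linear[of "psi F i j" "psi F i j" "-1" 0] psi_in_L2_cube[where F = F, OF assms] by simp
qed

end

section \<open>The excess risk\<close>

theorem theorem4:
  fixes M :: "'w measure"
    and Z :: "(real ^ 'd \<Rightarrow> real) \<Rightarrow> 'w \<Rightarrow> real"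
    and f :: "real ^ 'd \<Rightarrow> real"
    and F :: "nat \<Rightarrow> real ^ 'd \<Rightarrow> real"
    and \<epsilon> :: real and N :: nat and ibar :: "'w \<Rightarrow> nat"
  assumes "white_noise M Z"
    and "0 < \<epsilon>" and "\<epsilon> < 1"
    and "f \<in> L2_cube"
    and "N \<ge> 2"
    and "\<And>i. i \<in> {1..N} \<Longrightarrow> F i \<in> L2_cube"
    and "\<And>i j. i \<in> {1..N} \<Longrightarrow> j \<in> {1..N} \<Longrightarrow> i \<noteq> j \<Longrightarrow>
          \<not> (AE t in cube_measure. F i t = F j t)"
    and "ibar \<in> measurable M (count_space {1..N})"
    and "\<And>\<omega>. \<omega> \<in> space M \<Longrightarrow>
          is_arg_min (\<lambda>i. selection_stat N F (observation \<epsilon> f Z) i \<omega>) (\<lambda>i. i \<in> {1..N}) (ibar \<omega>)"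
  shows "risk M (\<lambda>\<omega>. F (ibar \<omega>)) f
    \<le> (MIN i\<in>{1..N}. L2_norm (\<lambda>t. F i t - f t)) + 8 * \<epsilon> * sqrt (2 * ln (real N))"
proof -
  interpret white_noise M Z by (rule assms(1))
  let ?I = "{1..N}"
  define a where "a = (\<lambda>i. L2_norm (\<lambda>t. F i t - f t))"
  define d where "d = (\<lambda>i j. L2_norm (\<lambda>t. F i t - F j t))"
  have I: "finite ?I" "?I \<noteq> {}" using assms(5) by auto
  have "Min (a ` ?I) \<in> a ` ?I" using I by (intro Min_in) auto
  then obtain i0 where i0: "i0 \<in> ?I" "Min (a ` ?I) = a i0" by auto
  have best: "a i0 \<le> a i" if "i \<in> ?I" for i
    using that I i0(2) Min_le[of "a ` ?I" "a i"] by simp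
  have d_pos: "0 < d i j" if "i \<in> ?I" "j \<in> ?I" "i \<noteq> j" for i j
    using that assms(6,7) by (auto simp: d_def intro: L2_norm_diff_pos)
  have d_le: "d i j \<le> a i + a j" if "i \<in> ?I" "j \<in> ?I" for i j
    unfolding a_def d_def using that assms(4,6) by (intro L2_norm_triangle_diff) auto
  have J: "card (?I - {i0}) + 1 = N"
    using i0(1) assms(5) by simp
  then have "card (?I - {i0}) \<noteq> 0"
    using assms(5) by linarith
  then have J_ne: "?I - {i0} \<noteq> {}"
    by (metis card.empty)
  have normal: "distributed M lborel (\<lambda>\<omega>. - Z (psi F i0 j) \<omega>) std_normal_density"
    if "j \<in> ?I - {i0}" for j
  proof (rule distributed_neg_noise)
    show "psi F i0 j \<in> L2_cube"
      using that i0(1) assms(6) by (intro psi_in_L2_cube) auto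
    show "L2_inner (psi F i0 j) (psi F i0 j) = 1"
      using that d_pos[of i0 j] i0(1) by (intro L2_inner_psi_self) (auto simp: d_def)
  qed
  obtain B where B: "integrable M B" "expectation B \<le> sqrt (2 * ln (card (?I - {i0}) + 1))"
      "\<And>\<omega>. 0 \<le> B \<omega>" "\<And>j \<omega>. j \<in> ?I - {i0} \<Longrightarrow> - Z (psi F i0 j) \<omega> \<le> B \<omega>"
    using standard_normal_majorant[of "?I - {i0}" "\<lambda>j \<omega>. - Z (psi F i0 j) \<omega>"] J_ne normal
    by blast
  have B_le: "expectation B \<le> sqrt (2 * ln (real N))"
    using B(2) J by (metis of_nat_1 of_nat_add)
  have ibar: "ibar \<omega> \<in> ?I" if "\<omega> \<in> space M" for \<omega>
    using assms(9)[OF that] by (simp add: is_arg_min_def)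
  \<comment> \<open>Linearity of the noise holds almost surely for each pair; there are finitely many.\<close>
  have antisym: "AE \<omega> in M. \<forall>i\<in>?I. Z (psi F i i0) \<omega> = - Z (psi F i0 i) \<omega>"
    using I(1) i0(1) assms(6) by (intro AE_finite_allI AE_noise_psi_antisym) auto
  have pathwise: "AE \<omega> in M. a (ibar \<omega>) \<le> a i0 + 4 * \<epsilon> * B \<omega>"
    using antisym AE_space
  proof eventually_elim
    case (elim \<omega>)
    let ?k = "ibar \<omega>"
    have stat: "selection_stat N F (observation \<epsilon> f Z) i \<omega>
        = (MAX j\<in>?I - {i}. ((a i)\<^sup>2 - (a j)\<^sup>2) / (2 * d i j) - \<epsilon> * Z (psi F i j) \<omega>)"
      if "i \<in> ?I" for i
      unfolding a_def d_def by (rule selection_stat_observation) (use assms(4,6) that in auto)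
    have "selection_stat N F (observation \<epsilon> f Z) ?k \<omega>
        \<le> selection_stat N F (observation \<epsilon> f Z) i0 \<omega>"
      using assms(9)[OF elim(2)] i0(1) by (auto simp: is_arg_min_linorder)
    then have min: "(MAX j\<in>?I - {?k}. ((a ?k)\<^sup>2 - (a j)\<^sup>2) / (2 * d ?k j) - \<epsilon> * Z (psi F ?k j) \<omega>)
        \<le> (MAX j\<in>?I - {i0}. ((a i0)\<^sup>2 - (a j)\<^sup>2) / (2 * d i0 j) - \<epsilon> * Z (psi F i0 j) \<omega>)"
      using stat[OF ibar[OF elim(2)]] stat[OF i0(1)] by simp
    have noise: "- (\<epsilon> * Z (psi F i0 j) \<omega>) \<le> \<epsilon> * B \<omega>" if "j \<in> ?I" "j \<noteq> i0" for j
      using mult_left_mono[OF B(4)[of j \<omega>], of \<epsilon>] that assms(2) by simp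
    have "a ?k - a i0 \<le> 4 * (\<epsilon> * B \<omega>)"
    proof (rule argmin_excess_le[where I = ?I and d = d and z = "\<lambda>i j. \<epsilon> * Z (psi F i j) \<omega>"])
      show "0 \<le> a i" for i by (simp add: a_def L2_norm_nonneg)
      show "0 \<le> \<epsilon> * B \<omega>" using B(3) assms(2) by simp
      show "\<epsilon> * Z (psi F ?k i0) \<omega> = - (\<epsilon> * Z (psi F i0 ?k) \<omega>)"
        using elim(1) ibar[OF elim(2)] by simp
    qed (use ibar[OF elim(2)] i0(1) best d_pos d_le min noise in auto)
    then show ?case by simp
  qed
  have a_int: "integrable M (\<lambda>\<omega>. a (ibar \<omega>))"
  proof (rule integrable_const_bound[where B = "Max (a ` ?I)"])
    show "(\<lambda>\<omega>. a (ibar \<omega>)) \<in> borel_measurable M"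
      using assms(8) by (rule measurable_compose) simp
    show "AE \<omega> in M. norm (a (ibar \<omega>)) \<le> Max (a ` ?I)"
      using ibar by (auto simp: a_def L2_norm_nonneg intro!: AE_I2 Max_ge)
  qed
  have "risk M (\<lambda>\<omega>. F (ibar \<omega>)) f = expectation (\<lambda>\<omega>. a (ibar \<omega>))"
    by (simp add: risk_def a_def)
  also have "\<dots> \<le> expectation (\<lambda>\<omega>. a i0 + 4 * \<epsilon> * B \<omega>)"
    using a_int B(1) pathwise by (intro integral_mono_AE) auto
  also have "\<dots> = a i0 + 4 * \<epsilon> * expectation B"
    using B(1) by (simp add: prob_space)
  also have "\<dots> \<le> a i0 + 8 * \<epsilon> * sqrt (2 * ln (real N))"
  proof -
    have "4 * \<epsilon> * expectation B \<le> 4 * \<epsilon> * sqrt (2 * ln (real N))"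
      using B_le assms(2) by (intro mult_left_mono) auto
    moreover have "0 \<le> \<epsilon> * sqrt (2 * ln (real N))"
      using assms(2,5) by simp
    ultimately show ?thesis by simp
  qed
  finally show ?thesis
    using i0(2) by (simp add: a_def)
qed

end
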